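(* Let $\Gamma$ be a subgroup of $\mathrm{Homeo}_+(\mathbb{R})$ without crossed elements. If $(x_n)$ is any dense sequence of points in the real line, then the order relation on $\Gamma$ associated to this sequence is a $\mathcal{C}$-order.
   Context: $\mathrm{Homeo}_+(\mathbb{R})$ is the group of orientation-preserving homeomorphisms of $\mathbb{R}$. The order associated to a dense sequence $(x_n)$ is the left-invariant total order on $\Gamma$ given by $g \prec h$ iff, for the smallest index $n$ such that $g(x_n)\neq h(x_n)$, one has $g(x_n) < h(x_n)$. Two orientation-preserving homeomorphisms of $\mathbb{R}$ are crossed on an interval $]a,b[$ if one of them fixes $a$ and $b$ and no other point in $[a,b]$, while the other one sends $a$ or $b$ into $]a,b[$. The cases $a=-\infty$ or $b=+\infty$ are allowed ($\pm\infty$ being regarded as fixed by every homeomorphism). A group is without crossed elements if no two of its elements are crossed on any interval. A left-invariant total order $\preceq$ on a group $\Gamma$ is a $\mathcal{C}$-order (satisfies the Conrad property) if for all $f \succ id$, $g \succ id$ there exists $n \in \mathbb{N}$ such that $fg^n \succ g$. *)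

theory Defs
  imports "HOL-Analysis.Analysis" "HOL-Algebra.Group"
begin

text \<open>On the real line, a homeomorphism preserves orientation iff it is increasing.\<close>

definition Homeo_plus :: "(real \<Rightarrow> real) monoid" where
  "Homeo_plus =
     \<lparr>carrier = {f. (\<exists>g. homeomorphism UNIV UNIV f g) \<and> strict_mono f},
      monoid.mult = (\<circ>), one = id\<rparr>"

lemma group_Homeo_plus: "group Homeo_plus"
proof (rule groupI)
  fix f g assume "f \<in> carrier Homeo_plus" "g \<in> carrier Homeo_plus"
  then obtain f' g' where
    h: "homeomorphism UNIV UNIV f f'" "homeomorphism UNIV UNIV g g'" "strict_mono f" "strict_mono g"
    by (auto simp: Homeo_plus_def)
  then have "homeomorphism UNIV UNIV (f \<circ> g) (g' \<circ> f')" "strict_mono (f \<circ> g)"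
    by (auto intro: homeomorphism_compose simp: strict_mono_def)
  then show "f \<otimes>\<^bsub>Homeo_plus\<^esub> g \<in> carrier Homeo_plus"
    by (auto simp: Homeo_plus_def)
next
  have "homeomorphism UNIV UNIV (id :: real \<Rightarrow> real) id"
    by (simp add: homeomorphism_def)
  then show "\<one>\<^bsub>Homeo_plus\<^esub> \<in> carrier Homeo_plus"
    by (auto simp: Homeo_plus_def strict_mono_def)
next
  fix f assume "f \<in> carrier Homeo_plus"
  then obtain f' where h: "homeomorphism UNIV UNIV f f'" "strict_mono f"
    by (auto simp: Homeo_plus_def)
  have inv: "f (f' t) = t" "f' (f t) = t" for t
    using h(1) by (auto simp: homeomorphism_def)
  have "strict_mono f'"
    using h(2) inv by (metis strict_mono_def strict_mono_less)
  moreover have "homeomorphism UNIV UNIV f' f"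
    using h(1) homeomorphism_sym by blast
  moreover have "f' \<circ> f = id"
    using inv by auto
  ultimately show "\<exists>y\<in>carrier Homeo_plus. y \<otimes>\<^bsub>Homeo_plus\<^esub> f = \<one>\<^bsub>Homeo_plus\<^esub>"
    by (auto simp: Homeo_plus_def)
qed (auto simp: Homeo_plus_def)

text \<open>The action on \<open>[-\<infinity>, \<infinity>]\<close>, fixing both ends.\<close>

definition extend_ereal :: "(real \<Rightarrow> real) \<Rightarrow> ereal \<Rightarrow> ereal" where
  "extend_ereal f t = (case t of ereal r \<Rightarrow> ereal (f r) | PInfty \<Rightarrow> \<infinity> | MInfty \<Rightarrow> -\<infinity>)"

definition crossed_on :: "(real \<Rightarrow> real) \<Rightarrow> (real \<Rightarrow> real) \<Rightarrow> ereal \<Rightarrow> ereal \<Rightarrow> bool" where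
  "crossed_on f g a b \<longleftrightarrow>
     a < b \<and>
     (\<exists>(u, v) \<in> {(f, g), (g, f)}.
        {t \<in> {a..b}. extend_ereal u t = t} = {a, b} \<and>
        (extend_ereal v a \<in> {a<..<b} \<or> extend_ereal v b \<in> {a<..<b}))"

definition without_crossed_elements :: "(real \<Rightarrow> real) set \<Rightarrow> bool" where
  "without_crossed_elements \<Gamma> \<longleftrightarrow> (\<forall>f\<in>\<Gamma>. \<forall>g\<in>\<Gamma>. \<forall>a b. \<not> crossed_on f g a b)"

text \<open>
  A weak order \<open>\<preceq>\<close> on a group is a set of pairs \<open>r\<close>, as in \<^const>\<open>linear_order_on\<close>;
  \<open>g \<prec> h\<close> is \<open>(g, h) \<in> r - Id\<close>.
\<close>

definition left_invariant_total_order :: "('a, 'b) monoid_scheme \<Rightarrow> 'a rel \<Rightarrow> bool" where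
  "left_invariant_total_order G r \<longleftrightarrow>
     linear_order_on (carrier G) r \<and>
     (\<forall>f\<in>carrier G. \<forall>(g, h)\<in>r. (f \<otimes>\<^bsub>G\<^esub> g, f \<otimes>\<^bsub>G\<^esub> h) \<in> r)"

definition C_order :: "('a, 'b) monoid_scheme \<Rightarrow> 'a rel \<Rightarrow> bool" where
  "C_order G r \<longleftrightarrow>
     left_invariant_total_order G r \<and>
     (\<forall>f\<in>carrier G. \<forall>g\<in>carrier G.
        (\<one>\<^bsub>G\<^esub>, f) \<in> r - Id \<longrightarrow> (\<one>\<^bsub>G\<^esub>, g) \<in> r - Id \<longrightarrow>
        (\<exists>n::nat. (g, f \<otimes>\<^bsub>G\<^esub> g [^]\<^bsub>G\<^esub> n) \<in> r - Id))"

definition sequence_less :: "(nat \<Rightarrow> real) \<Rightarrow> (real \<Rightarrow> real) \<Rightarrow> (real \<Rightarrow> real) \<Rightarrow> bool" where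
  "sequence_less x g h \<longleftrightarrow>
     (\<exists>n. g (x n) \<noteq> h (x n)) \<and>
     (let n = (LEAST n. g (x n) \<noteq> h (x n)) in g (x n) < h (x n))"

definition sequence_order :: "(nat \<Rightarrow> real) \<Rightarrow> (real \<Rightarrow> real) set \<Rightarrow> (real \<Rightarrow> real) rel" where
  "sequence_order x \<Gamma> = {(g, h) \<in> \<Gamma> \<times> \<Gamma>. sequence_less x g h \<or> g = h}"

text \<open>
  Allowing the exponent \<open>0\<close> in \<^const>\<open>C_order\<close> makes no difference: if \<open>f \<succ> g\<close>
  then \<open>f g \<succ> f \<succ> g\<close>.
\<close>

lemma C_order_iff_positive_exponent:
  assumes "group G"
  shows "C_order G r \<longleftrightarrow>
     left_invariant_total_order G r \<and>
     (\<forall>f\<in>carrier G. \<forall>g\<in>carrier G.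
        (\<one>\<^bsub>G\<^esub>, f) \<in> r - Id \<longrightarrow> (\<one>\<^bsub>G\<^esub>, g) \<in> r - Id \<longrightarrow>
        (\<exists>n>0. (g, f \<otimes>\<^bsub>G\<^esub> g [^]\<^bsub>G\<^esub> (n::nat)) \<in> r - Id))"
proof -
  interpret group G by fact
  have step: "\<exists>n>0. (g, f \<otimes>\<^bsub>G\<^esub> g [^]\<^bsub>G\<^esub> (n::nat)) \<in> r - Id"
    if ord: "left_invariant_total_order G r" and "f \<in> carrier G" "g \<in> carrier G"
      and g: "(\<one>\<^bsub>G\<^esub>, g) \<in> r - Id" and n: "(g, f \<otimes>\<^bsub>G\<^esub> g [^]\<^bsub>G\<^esub> (n::nat)) \<in> r - Id" for f g n
  proof (cases "n = 0")
    case True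
    have "(f, f \<otimes>\<^bsub>G\<^esub> g) \<in> r"
      using ord g that(2,3) by (force simp: left_invariant_total_order_def)
    moreover have "(g, f) \<in> r" "g \<noteq> f"
      using n True that(2,3) by auto
    moreover have "trans r" "antisym r"
      using ord by (auto simp: left_invariant_total_order_def order_on_defs)
    ultimately have "(g, f \<otimes>\<^bsub>G\<^esub> g) \<in> r - Id"
      by (auto dest: transD antisymD)
    then show ?thesis
      using that(3) by (intro exI[of _ 1]) auto
  qed (use n in blast)
  show ?thesis
    unfolding C_order_def using step by blast
qed

end

theory Submission
  imports Defs
begin

text \<open>
  Let \<open>p\<close> be the first point of the sequence moved by \<open>f\<close> or \<open>g\<close>, where both are positive.
  If \<open>f g\<^sup>n \<preceq> g\<close> for all \<open>n\<close>, then \<open>f (g\<^sup>n p) \<le> g p\<close> for all \<open>n\<close>, so \<open>g\<close> moves \<open>p\<close> and the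
  orbit \<open>g\<^sup>n p\<close> is bounded, hence increases to a fixed point \<open>b\<close> of \<open>g\<close> with
  \<open>p \<le> f p < f b \<le> g p < b\<close>. With \<open>a\<close> the last fixed point of \<open>g\<close> before \<open>p\<close> (or \<open>-\<infinity>\<close>),
  \<open>f\<close> and \<open>g\<close> are crossed on \<open>]a, b[\<close>.
\<close>

lemma sequence_less_iff:
  "sequence_less x g h \<longleftrightarrow> (\<exists>n. g (x n) < h (x n) \<and> (\<forall>i<n. g (x i) = h (x i)))"
proof
  assume "sequence_less x g h"
  then show "\<exists>n. g (x n) < h (x n) \<and> (\<forall>i<n. g (x i) = h (x i))"
    unfolding sequence_less_def Let_def by (blast dest: not_less_Least)
next
  assume "\<exists>n. g (x n) < h (x n) \<and> (\<forall>i<n. g (x i) = h (x i))"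
  then obtain n where n: "g (x n) < h (x n)" "\<And>i. i < n \<Longrightarrow> g (x i) = h (x i)"
    by blast
  then have "(LEAST n. g (x n) \<noteq> h (x n)) = n"
    by (intro Least_equality) (auto simp: not_less[symmetric])
  with n show "sequence_less x g h"
    unfolding sequence_less_def Let_def by (metis less_irrefl)
qed

lemma sequence_less_irrefl: "\<not> sequence_less x g g"
  by (simp add: sequence_less_def)

lemma sequence_less_trans:
  assumes "sequence_less x f g" "sequence_less x g h"
  shows "sequence_less x f h"
proof -
  obtain m n where m: "f (x m) < g (x m)" "\<forall>i<m. f (x i) = g (x i)"
    and n: "g (x n) < h (x n)" "\<forall>i<n. g (x i) = h (x i)"
    using assms by (auto simp: sequence_less_iff)
  \<comment> \<open>At the smaller of the two indices one comparison is strict and the other is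
    strict or an equality.\<close>
  have "f (x (min m n)) < h (x (min m n))"
    using m n by (cases m n rule: linorder_cases) auto
  moreover have "\<forall>i < min m n. f (x i) = h (x i)"
    using m n by simp
  ultimately show ?thesis
    by (auto simp: sequence_less_iff)
qed

text \<open>Density is used here: continuous maps that agree on a dense set are equal, so distinct
  ones differ at some \<open>x n\<close>.\<close>

lemma sequence_less_total:
  assumes "continuous_on UNIV g" "continuous_on UNIV h" "closure (range x) = UNIV" "g \<noteq> h"
  shows "sequence_less x g h \<or> sequence_less x h g"
proof -
  have "\<exists>n. g (x n) \<noteq> h (x n)"
  proof (rule ccontr)
    assume "\<nexists>n. g (x n) \<noteq> h (x n)"
    then have "range x \<subseteq> {t. g t = h t}"
      by auto
    moreover have "closed {t. g t = h t}"
      using assms(1,2) by (rule closed_Collect_eq)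
    ultimately have "closure (range x) \<subseteq> {t. g t = h t}"
      by (rule closure_minimal)
    with assms(3,4) show False
      by auto
  qed
  then obtain n where "g (x n) \<noteq> h (x n)" "\<And>i. i < n \<Longrightarrow> g (x i) = h (x i)"
    using exists_least_iff[of "\<lambda>n. g (x n) \<noteq> h (x n)"] by blast
  then show ?thesis
    unfolding sequence_less_iff by (metis linorder_neqE)
qed

lemma sequence_less_left_mono:
  assumes "strict_mono f" "sequence_less x g h"
  shows "sequence_less x (f \<circ> g) (f \<circ> h)"
  using assms by (fastforce simp: sequence_less_iff strict_mono_less)

lemma Homeo_plusD:
  assumes "f \<in> carrier Homeo_plus"
  shows "strict_mono f" "continuous_on UNIV f" "surj f"
  using assms by (auto simp: Homeo_plus_def homeomorphism_def)

lemma nat_pow_Homeo_plus: "g [^]\<^bsub>Homeo_plus\<lparr>carrier := \<Gamma>\<rparr>\<^esub> (n::nat) = g ^^ n"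
proof (induction n)
  case (Suc n)
  then show ?case
    \<comment> \<open>The group power multiplies by the new factor on the right.\<close>
    unfolding funpow_Suc_right by (simp add: nat_pow_def Homeo_plus_def)
qed (simp add: nat_pow_def Homeo_plus_def)

lemma left_invariant_sequence_order:
  assumes "subgroup \<Gamma> Homeo_plus" "closure (range x) = UNIV"
  shows "left_invariant_total_order (Homeo_plus\<lparr>carrier := \<Gamma>\<rparr>) (sequence_order x \<Gamma>)"
proof -
  note H = Homeo_plusD[OF subsetD[OF subgroup.subset[OF assms(1)]]]
  have comp: "f \<circ> g \<in> \<Gamma>" if "f \<in> \<Gamma>" "g \<in> \<Gamma>" for f g
    using subgroup.m_closed[OF assms(1) that] by (simp add: Homeo_plus_def)
  have "linear_order_on \<Gamma> (sequence_order x \<Gamma>)"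
    unfolding order_on_defs
  proof (intro conjI)
    show "sequence_order x \<Gamma> \<subseteq> \<Gamma> \<times> \<Gamma>" "refl_on \<Gamma> (sequence_order x \<Gamma>)"
      by (auto simp: sequence_order_def refl_on_def)
    show "trans (sequence_order x \<Gamma>)"
      by (auto simp: sequence_order_def trans_def intro: sequence_less_trans)
    show "antisym (sequence_order x \<Gamma>)"
      by (auto simp: sequence_order_def antisym_def sequence_less_irrefl
          dest: sequence_less_trans)
    show "total_on \<Gamma> (sequence_order x \<Gamma>)"
      using sequence_less_total[OF H(2) H(2) assms(2)]
      by (auto simp: sequence_order_def total_on_def)
  qed
  then show ?thesis
    using comp H(1)
    by (auto simp: left_invariant_total_order_def sequence_order_def
        \<comment> \<open>Unfolds \<open>Homeo_plus\<close> under \<open>monoid.mult\<close> only,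
          so that the product becomes composition.\<close>
        Homeo_plus_def[THEN arg_cong[where f = monoid.mult]]
        intro: sequence_less_left_mono)
qed

text \<open>Supplies the left end of the crossing interval. The fixed points up to \<open>p\<close>
  form a closed set, which contains its supremum if nonempty; otherwise \<open>-\<infinity>\<close>
  serves.\<close>

lemma last_fixed_point_before:
  fixes g :: "real \<Rightarrow> real"
  assumes "continuous_on UNIV g" "g p \<noteq> p"
  obtains a where "a < ereal p" "extend_ereal g a = a" "\<And>t. a < ereal t \<Longrightarrow> t \<le> p \<Longrightarrow> g t \<noteq> t"
proof (cases "\<exists>t\<le>p. g t = t")
  case True
  let ?A = "{t. g t = t} \<inter> {..p}"
  have "closed ?A"
    by (intro closed_Int closed_Collect_eq assms(1) continuous_on_id closed_atMost)
  moreover have bdd: "bdd_above ?A"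
    by (intro bdd_aboveI[of _ p]) auto
  moreover have "?A \<noteq> {}"
    using True by auto
  ultimately have "Sup ?A \<in> ?A"
    by (intro closed_contains_Sup)
  moreover have "t \<le> Sup ?A" if "g t = t" "t \<le> p" for t
    using that bdd by (intro cSup_upper) auto
  moreover from calculation have "Sup ?A \<noteq> p"
    using assms(2) by auto
  ultimately show ?thesis
    by (intro that[of "ereal (Sup ?A)"]) (fastforce simp: extend_ereal_def)+
next
  case False
  then show ?thesis
    by (intro that[of "-\<infinity>"]) (auto simp: extend_ereal_def)
qed

text \<open>Supplies the right end. The orbit is increasing and bounded, and continuity makes its
  limit a fixed point. By monotonicity every fixed point beyond \<open>p\<close> bounds the orbit,
  hence also the limit.\<close>

lemma orbit_limit_fixed_point:
  fixes g :: "real \<Rightarrow> real"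
  assumes "strict_mono g" "continuous_on UNIV g" "p < g p" "\<And>n. (g ^^ n) p \<le> c"
  obtains b where "(\<lambda>n. (g ^^ n) p) \<longlonglongrightarrow> b" "g b = b" "g p < b" "\<And>t. p \<le> t \<Longrightarrow> g t = t \<Longrightarrow> b \<le> t"
proof -
  have "mono g"
    using assms(1) by (rule strict_mono_mono)
  have "incseq (\<lambda>n. (g ^^ n) p)"
    using \<open>mono g\<close> assms(3) by (intro incseq_SucI) (simp add: funpow_mono funpow_swap1 less_imp_le)
  then obtain b where lim: "(\<lambda>n. (g ^^ n) p) \<longlonglongrightarrow> b" and le: "\<And>n. (g ^^ n) p \<le> b"
    using incseq_convergent assms(4) by blast
  have "(\<lambda>n. g ((g ^^ n) p)) \<longlonglongrightarrow> g b"
    using lim assms(2) by (intro isCont_tendsto_compose[of b g]) (auto simp: continuous_on_eq_continuous_at)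
  then have "g b = b"
    using LIMSEQ_unique LIMSEQ_Suc[OF lim] by simp
  have "b \<le> t" if "p \<le> t" "g t = t" for t
  proof -
    have "(g ^^ n) t = t" for n
      using that(2) by (induction n) auto
    then have "(g ^^ n) p \<le> t" for n
      using funpow_mono[OF \<open>mono g\<close> that(1), of n] by simp
    then show ?thesis
      using lim by (intro LIMSEQ_le_const2) auto
  qed
  moreover have "g p < b"
    \<comment> \<open>From \<open>p < g p \<le> b\<close>, applying \<open>g\<close> to
      \<open>p < b\<close> gives the strict bound.\<close>
    using strict_monoD[OF assms(1), of p b] le[of 1] \<open>g b = b\<close> assms(3) by simp
  ultimately show ?thesis
    using that lim \<open>g b = b\<close> by blast
qed

text \<open>The hypothesis on \<open>f\<close> is weak because the first point moved may be moved by
  \<open>g\<close> alone.\<close>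

lemma without_crossed_elements_escape:
  assumes "\<And>a b. \<not> crossed_on f g a b"
    and "f \<in> carrier Homeo_plus" "g \<in> carrier Homeo_plus" "p \<le> f p" "p < g p"
  shows "\<exists>n. g p < f ((g ^^ n) p)"
proof (rule ccontr)
  note f = Homeo_plusD[OF assms(2)] and g = Homeo_plusD[OF assms(3)]
  assume "\<nexists>n. g p < f ((g ^^ n) p)"
  then have le: "f ((g ^^ n) p) \<le> g p" for n
    by (simp add: not_less)
  \<comment> \<open>The preimage of \<open>g p\<close> under \<open>f\<close> bounds the whole
    orbit, as \<open>f\<close> is increasing.\<close>
  obtain c where c: "f c = g p"
    using f(3) by (metis surjD)
  have "(g ^^ n) p \<le> c" for n
    using le[of n] strict_mono_less_eq[OF f(1), of "(g ^^ n) p" c] c by simp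
  then obtain b where lim: "(\<lambda>n. (g ^^ n) p) \<longlonglongrightarrow> b" and b: "g b = b" "g p < b"
    and b_least: "\<And>t. p \<le> t \<Longrightarrow> g t = t \<Longrightarrow> b \<le> t"
    using orbit_limit_fixed_point[OF g(1,2) assms(5)] by blast
  have "(\<lambda>n. f ((g ^^ n) p)) \<longlonglongrightarrow> f b"
    using lim f(2) by (intro isCont_tendsto_compose[of b f]) (auto simp: continuous_on_eq_continuous_at)
  then have "f b \<le> g p"
    using le by (intro LIMSEQ_le_const2) auto
  moreover have "f p < f b"
    using f(1) assms(5) b(2) by (simp add: strict_mono_less)
  ultimately have fb: "p < f b" "f b < b"
    using assms(4) b(2) by auto
  obtain a where a: "a < ereal p" "extend_ereal g a = a"
    and a_last: "\<And>t. a < ereal t \<Longrightarrow> t \<le> p \<Longrightarrow> g t \<noteq> t"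
    using last_fixed_point_before[OF g(2), of p] assms(5) by auto
  have ab: "a < ereal b"
    using a(1) fb by (intro less_trans[OF a(1)]) simp
  \<comment> \<open>A fixed point strictly between would be real: at or below \<open>p\<close> it
    contradicts the choice of \<open>a\<close>, at or above \<open>p\<close> the minimality of
    \<open>b\<close>.\<close>
  have "t = a \<or> t = ereal b" if t: "a \<le> t" "t \<le> ereal b" "extend_ereal g t = t" for t
  proof (rule ccontr)
    assume "\<not> (t = a \<or> t = ereal b)"
    with t(1,2) have "a < t" "t < ereal b"
      by auto
    then obtain s where "t = ereal s" "a < ereal s" "s < b"
      by (cases t) auto
    with t(3) have "g s = s"
      by (simp add: extend_ereal_def)
    with a_last b_least \<open>a < ereal s\<close> \<open>s < b\<close> show False
      by (meson linorder_not_le nle_le)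
  qed
  then have "{t \<in> {a..ereal b}. extend_ereal g t = t} = {a, ereal b}"
    using a(2) ab b(1) by (auto simp: extend_ereal_def)
  \<comment> \<open>The map \<open>f\<close> sends the right end inside, since
    \<open>a < p < f b < b\<close>.\<close>
  moreover have "extend_ereal f (ereal b) \<in> {a<..<ereal b}"
    using fb a(1) by (auto simp: extend_ereal_def intro: less_trans[OF a(1)])
  ultimately have "crossed_on f g a (ereal b)"
    using ab by (auto simp: crossed_on_def)
  with assms(1) show False
    by blast
qed

theorem proposition3p18:
  fixes \<Gamma> :: "(real \<Rightarrow> real) set" and x :: "nat \<Rightarrow> real"
  assumes "subgroup \<Gamma> Homeo_plus"
    and "without_crossed_elements \<Gamma>"
    and "closure (range x) = UNIV"
  shows "C_order (Homeo_plus\<lparr>carrier := \<Gamma>\<rparr>) (sequence_order x \<Gamma>)"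
proof -
  have in_Homeo: "f \<in> carrier Homeo_plus" if "f \<in> \<Gamma>" for f
    using that subgroup.subset[OF assms(1)] by blast
  have comp: "f \<circ> g \<in> \<Gamma>" if "f \<in> \<Gamma>" "g \<in> \<Gamma>" for f g
    using subgroup.m_closed[OF assms(1) that] by (simp add: Homeo_plus_def)
  have "id \<in> \<Gamma>"
    using subgroup.one_closed[OF assms(1)] by (simp add: Homeo_plus_def)
  then have pow: "g ^^ n \<in> \<Gamma>" if "g \<in> \<Gamma>" for g n
    using that comp by (induction n) auto
  have "\<exists>n. sequence_less x g (f \<circ> g ^^ n)"
    if "f \<in> \<Gamma>" "g \<in> \<Gamma>" and pos: "sequence_less x id f" "sequence_less x id g" for f g
  proof -
    obtain i j where i: "x i < f (x i)" "\<And>k. k < i \<Longrightarrow> f (x k) = x k"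
      and j: "x j < g (x j)" "\<And>k. k < j \<Longrightarrow> g (x k) = x k"
      using pos by (auto simp: sequence_less_iff)
    \<comment> \<open>The first index whose point is moved by \<open>f\<close> or
      \<open>g\<close>.\<close>
    let ?m = "min i j"
    have "\<exists>n. g (x ?m) < f ((g ^^ n) (x ?m))"
    proof (cases "i < j")
      case True
      \<comment> \<open>Here \<open>g\<close> fixes \<open>x i\<close> while \<open>f\<close> moves
        it up, so the exponent \<open>0\<close> suffices.\<close>
      then show ?thesis
        using i(1) j(2) by (intro exI[of _ 0]) simp
    next
      case False
      \<comment> \<open>Strict if \<open>i = j\<close>; if \<open>j < i\<close>, then
        \<open>f\<close> fixes \<open>x j\<close>.\<close>
      then have "x j \<le> f (x j)"
        using i by (cases "i = j") (auto simp: less_imp_le)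
      then have "\<exists>n. g (x j) < f ((g ^^ n) (x j))"
        using that(1,2) j(1) assms(2) in_Homeo
        by (intro without_crossed_elements_escape) (auto simp: without_crossed_elements_def)
      with False show ?thesis
        by (simp add: min_def)
    qed
    \<comment> \<open>All earlier points are fixed by both maps, so for every \<open>n\<close> the
      comparison is not decided before \<open>?m\<close>.\<close>
    moreover have "g (x k) = f ((g ^^ n) (x k))" if "k < ?m" for n k
    proof -
      have "(g ^^ n) (x k) = x k"
        using j(2) that by (induction n) auto
      with i(2) j(2) that show ?thesis
        by simp
    qed
    ultimately show ?thesis
      by (force simp: sequence_less_iff)
  qed
  moreover have "(g, h) \<in> sequence_order x \<Gamma> - Id \<longleftrightarrow> g \<in> \<Gamma> \<and> h \<in> \<Gamma> \<and> sequence_less x g h" for g h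
    by (auto simp: sequence_order_def sequence_less_irrefl)
  moreover have "\<one>\<^bsub>Homeo_plus\<lparr>carrier := \<Gamma>\<rparr>\<^esub> = id"
    "f \<otimes>\<^bsub>Homeo_plus\<lparr>carrier := \<Gamma>\<rparr>\<^esub> g = f \<circ> g" for f g
    by (simp_all add: Homeo_plus_def)
  ultimately show ?thesis
    using left_invariant_sequence_order[OF assms(1,3)] comp pow
    by (auto simp: C_order_def nat_pow_Homeo_plus)
qed

end
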